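(* Let $\mathcal D$ be the stream comonad on $\mathbf{Set}$, $R\in\mathbf{Set}$ and $S=(S_0,\mathbb N\Rightarrow R)\in\mathbf{Pred}$ a single lifting parameter for $\mathcal D$, and let $\dot D$ be the density lifting of $\mathcal D$ along $p:\mathbf{Pred}\to\mathbf{Set}$ with this parameter. Then for any $X\in\mathbf{Pred}$ and $x\in\mathbb N\Rightarrow X_1$: $$x\in(\dot DX)_0\iff\exists v\in S_0.\ \big(\forall i\in\mathbb N.\ v/i\in S_0\implies x(i)\in X_0\big)\wedge\big(\forall m,n\in\mathbb N.\ v/n=v/m\implies x(n)=x(m)\big).$$
   Context: $\mathbf{Pred}$: objects are pairs $X=(X_0,X_1)$ of sets with $X_0\subseteq X_1$; morphisms $(X_0,X_1)\to(Y_0,Y_1)$ are functions $f:X_1\to Y_1$ with $f(X_0)\subseteq Y_0$; $p(X_0,X_1)=X_1$. The stream comonad $\mathcal D$ on $\mathbf{Set}$ has $DI=\mathbb N\Rightarrow I$ (infinite sequences), counit $\epsilon_I(l)=l(0)$, comultiplication $\delta_I(l)(m)=l/m$, where $l/i=\lambda j.\,l(i+j)$; the co-Kleisli extension of $f:DI\to J$ is $f^\flat=Df\circ\delta_I$, i.e. $f^\flat(s)=\lambda m.f(s/m)$. For a single lifting parameter ($R\in\mathbf{Set}$, $S\in\mathbf{Pred}$ with $S_1=DR$), the density lifting (dual of the codensity lifting, along the cofibration $p$) is the comonad $\dot D$ on $\mathbf{Pred}$ lifting $\mathcal D$ with object part $\dot DX=(\{(pf)^\flat(s)\mid f\in\mathbf{Pred}(S,X),s\in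 S_0\},DX_1)=(\{\lambda m.f(s/m)\mid f\in\mathbf{Pred}(S,X),s\in S_0\},\mathbb N\Rightarrow X_1)$. *)

theory Defs
  imports Main "HOL-Library.FuncSet"
begin

text \<open>
  Objects of \<open>Set\<close> are sets over some type, and \<open>Set(I, J)\<close> is \<open>I \<rightarrow>\<^sub>E J\<close>: extensional functions,
  so that equality of arrows is HOL equality. The object maps below are polymorphic, hence defined
  for sets over arbitrary types.
\<close>

section \<open>The category Pred\<close>

type_synonym 'a pred_obj = "'a set \<times> 'a set"

definition is_pred :: "'a pred_obj \<Rightarrow> bool" where
  "is_pred X \<longleftrightarrow> fst X \<subseteq> snd X"

definition Pred_hom :: "'a pred_obj \<Rightarrow> 'b pred_obj \<Rightarrow> ('a \<Rightarrow> 'b) set" where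
  "Pred_hom X Y = {f \<in> snd X \<rightarrow>\<^sub>E snd Y. f ` fst X \<subseteq> fst Y}"

definition p_obj :: "'a pred_obj \<Rightarrow> 'a set" where
  "p_obj X = snd X"

definition p_mor :: "('a \<Rightarrow> 'b) \<Rightarrow> 'a \<Rightarrow> 'b" where
  "p_mor f = f"

section \<open>The stream comonad\<close>

definition D_obj :: "'a set \<Rightarrow> (nat \<Rightarrow> 'a) set" where
  "D_obj I = UNIV \<rightarrow>\<^sub>E I"

definition D_map :: "'a set \<Rightarrow> ('a \<Rightarrow> 'b) \<Rightarrow> (nat \<Rightarrow> 'a) \<Rightarrow> nat \<Rightarrow> 'b" where
  "D_map I f = (\<lambda>l\<in>D_obj I. \<lambda>i. f (l i))"

text \<open>\<open>l \<oslash> i\<close> is the suffix written \<open>l/i\<close> in the mathematics.\<close>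

definition suffix :: "(nat \<Rightarrow> 'a) \<Rightarrow> nat \<Rightarrow> nat \<Rightarrow> 'a"  (infixl "\<oslash>" 70) where
  "l \<oslash> i = (\<lambda>j. l (i + j))"

definition D_counit :: "'a set \<Rightarrow> (nat \<Rightarrow> 'a) \<Rightarrow> 'a" where
  "D_counit I = (\<lambda>l\<in>D_obj I. l 0)"

definition D_comult :: "'a set \<Rightarrow> (nat \<Rightarrow> 'a) \<Rightarrow> nat \<Rightarrow> nat \<Rightarrow> 'a" where
  "D_comult I = (\<lambda>l\<in>D_obj I. \<lambda>m. l \<oslash> m)"

text \<open>The co-Kleisli extension \<open>D f \<circ> \<delta>\<^sub>I\<close> of \<open>f : D I \<rightarrow> J\<close>.\<close>

definition D_coext :: "'a set \<Rightarrow> ((nat \<Rightarrow> 'a) \<Rightarrow> 'b) \<Rightarrow> (nat \<Rightarrow> 'a) \<Rightarrow> nat \<Rightarrow> 'b" where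
  "D_coext I f = compose (D_obj I) (D_map (D_obj I) f) (D_comult I)"

section \<open>The density lifting\<close>

text \<open>The parameter is \<open>R\<close> together with \<open>S\<close> such that \<open>p S = D R\<close>.\<close>

definition density_lifting ::
    "'r set \<Rightarrow> (nat \<Rightarrow> 'r) pred_obj \<Rightarrow> 'a pred_obj \<Rightarrow> (nat \<Rightarrow> 'a) pred_obj" where
  "density_lifting R S X =
     ({D_coext R (p_mor f) s |f s. f \<in> Pred_hom S X \<and> s \<in> fst S}, D_obj (p_obj X))"

section \<open>Comonad structure of the stream comonad and of its density lifting\<close>

lemma Pred_homI:
  "f \<in> snd X \<rightarrow>\<^sub>E snd Y \<Longrightarrow> (\<And>a. a \<in> fst X \<Longrightarrow> f a \<in> fst Y) \<Longrightarrow> f \<in> Pred_hom X Y"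
  by (auto simp: Pred_hom_def)

lemma Pred_homD:
  assumes "f \<in> Pred_hom X Y"
  shows "f \<in> snd X \<rightarrow>\<^sub>E snd Y"
    and "a \<in> snd X \<Longrightarrow> f a \<in> snd Y"
    and "a \<in> fst X \<Longrightarrow> f a \<in> fst Y"
  using assms by (auto simp: Pred_hom_def)

lemma in_D_obj_iff: "l \<in> D_obj I \<longleftrightarrow> (\<forall>i. l i \<in> I)"
  by (auto simp: D_obj_def PiE_def)

lemma suffix_in_D_obj: "l \<in> D_obj I \<Longrightarrow> l \<oslash> i \<in> D_obj I"
  by (simp add: in_D_obj_iff suffix_def)

lemma suffix_0: "l \<oslash> 0 = l"
  by (simp add: suffix_def)

lemma suffix_suffix: "l \<oslash> i \<oslash> j = l \<oslash> (i + j)"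
  by (simp add: suffix_def add.assoc)

lemma D_map_in_hom: "f \<in> I \<rightarrow>\<^sub>E J \<Longrightarrow> D_map I f \<in> D_obj I \<rightarrow>\<^sub>E D_obj J"
  by (auto simp: D_map_def in_D_obj_iff PiE_iff)

lemma D_counit_in_hom: "D_counit I \<in> D_obj I \<rightarrow>\<^sub>E I"
  by (auto simp: D_counit_def in_D_obj_iff)

lemma D_comult_in_hom: "D_comult I \<in> D_obj I \<rightarrow>\<^sub>E D_obj (D_obj I)"
  by (auto simp: D_comult_def in_D_obj_iff suffix_def)

lemma D_comult_apply: "l \<in> D_obj I \<Longrightarrow> D_comult I l = (\<lambda>m. l \<oslash> m)"
  by (simp add: D_comult_def)

lemma D_coext_apply: "s \<in> D_obj I \<Longrightarrow> D_coext I f s = (\<lambda>m. f (s \<oslash> m))"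
  using D_comult_in_hom[of I]
  by (auto simp: D_coext_def compose_def D_map_def D_comult_apply dest: PiE_mem)

lemma D_comonad_laws:
  assumes "l \<in> D_obj I"
  shows "D_counit (D_obj I) (D_comult I l) = l"
    and "D_map (D_obj I) (D_counit I) (D_comult I l) = l"
    and "D_comult (D_obj I) (D_comult I l) = D_map (D_obj I) (D_comult I) (D_comult I l)"
proof -
  have *: "(\<lambda>m. l \<oslash> m) \<in> D_obj (D_obj I)"
    using assms by (simp add: in_D_obj_iff suffix_def)
  show "D_counit (D_obj I) (D_comult I l) = l"
    using assms * by (simp add: D_comult_apply D_counit_def suffix_0)
  show "D_map (D_obj I) (D_counit I) (D_comult I l) = l"
    using assms * by (simp add: D_comult_apply D_counit_def D_map_def suffix_in_D_obj)
      (simp add: suffix_def)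
  show "D_comult (D_obj I) (D_comult I l) = D_map (D_obj I) (D_comult I) (D_comult I l)"
    using assms * by (simp add: D_comult_apply D_map_def suffix_in_D_obj suffix_suffix)
      (simp add: suffix_def add.assoc)
qed

context
  fixes R :: "'r set" and S :: "(nat \<Rightarrow> 'r) pred_obj"
  assumes S: "is_pred S" "p_obj S = D_obj R"
begin

lemma density_lifting_eq:
  "density_lifting R S X =
     ({\<lambda>m. f (s \<oslash> m) |f s. f \<in> Pred_hom S X \<and> s \<in> fst S}, D_obj (snd X))"
proof -
  have "s \<in> fst S \<Longrightarrow> s \<in> D_obj R" for s
    using S by (auto simp: is_pred_def p_obj_def)
  then have "l = D_coext R f s \<and> f \<in> Pred_hom S X \<and> s \<in> fst S \<longleftrightarrow>
      l = (\<lambda>m. f (s \<oslash> m)) \<and> f \<in> Pred_hom S X \<and> s \<in> fst S" for l f s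
    using D_coext_apply[of s R f] by auto
  then show ?thesis
    by (simp add: density_lifting_def p_mor_def p_obj_def)
qed

lemma p_density_lifting: "p_obj (density_lifting R S X) = D_obj (p_obj X)"
  by (simp add: density_lifting_def p_obj_def)

lemma coext_in_D_obj:
  assumes "f \<in> Pred_hom S X" and "t \<in> D_obj R"
  shows "(\<lambda>m. f (t \<oslash> m)) \<in> D_obj (snd X)"
  unfolding in_D_obj_iff
  using Pred_homD(2)[OF assms(1)] suffix_in_D_obj[OF assms(2)] S by (simp add: p_obj_def)

lemma is_pred_density_lifting: "is_pred (density_lifting R S X)"
  unfolding density_lifting_eq is_pred_def
  using S by (auto intro!: coext_in_D_obj simp: is_pred_def p_obj_def)

lemma coext_in_hom:
  assumes "f \<in> Pred_hom S X"
  shows "D_coext R (p_mor f) \<in> Pred_hom S (density_lifting R S X)"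
proof (rule Pred_homI)
  have "D_coext R f \<in> D_obj R \<rightarrow>\<^sub>E D_obj (snd X)"
    by (rule PiE_I) (simp_all add: D_coext_apply coext_in_D_obj[OF assms], simp add: D_coext_def compose_def)
  then show "D_coext R (p_mor f) \<in> snd S \<rightarrow>\<^sub>E snd (density_lifting R S X)"
    using S by (simp add: p_mor_def p_obj_def density_lifting_def)
  show "D_coext R (p_mor f) s \<in> fst (density_lifting R S X)" if "s \<in> fst S" for s
    using that assms by (auto simp: density_lifting_def)
qed

text \<open>\<open>density_lifting R S X\<close> is the final lift: the least predicate on \<open>D (p X)\<close> for which every
  \<open>(p f)\<^sup>\<flat>\<close> with \<open>f : S \<rightarrow> X\<close> lifts to \<open>Pred\<close>.\<close>

lemma density_lifting_least:
  assumes "\<And>f. f \<in> Pred_hom S X \<Longrightarrow> D_coext R (p_mor f) \<in> Pred_hom S (P, D_obj (p_obj X))"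
  shows "fst (density_lifting R S X) \<subseteq> P"
  using assms by (fastforce simp: density_lifting_def Pred_hom_def)

lemma density_lifting_map:
  assumes "is_pred X" "g \<in> Pred_hom X Y"
  shows "D_map (p_obj X) (p_mor g) \<in> Pred_hom (density_lifting R S X) (density_lifting R S Y)"
proof -
  have 1: "D_map (snd X) g \<in> D_obj (snd X) \<rightarrow>\<^sub>E D_obj (snd Y)"
    using assms by (intro D_map_in_hom) (simp add: Pred_hom_def)
  have "D_map (snd X) g (\<lambda>m. f (s \<oslash> m)) \<in> fst (density_lifting R S Y)"
    if f: "f \<in> Pred_hom S X" and s: "s \<in> fst S" for f s
  proof -
    have dr: "s \<oslash> m \<in> snd S" for m
      using S s by (auto simp: is_pred_def p_obj_def in_D_obj_iff suffix_def)
    have h: "compose (snd S) g f \<in> Pred_hom S Y"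
    proof (rule Pred_homI)
      show "compose (snd S) g f \<in> snd S \<rightarrow>\<^sub>E snd Y"
        using Pred_homD(2)[OF f] Pred_homD(2)[OF assms(2)] by (auto simp: compose_def)
      show "compose (snd S) g f t \<in> fst Y" if "t \<in> fst S" for t
        using that S Pred_homD(3)[OF f] Pred_homD(3)[OF assms(2)]
        by (auto simp: compose_def is_pred_def)
    qed
    have "(\<lambda>m. f (s \<oslash> m)) \<in> D_obj (snd X)"
      using Pred_homD(2)[OF f] dr by (simp add: in_D_obj_iff)
    then have "D_map (snd X) g (\<lambda>m. f (s \<oslash> m)) = (\<lambda>m. compose (snd S) g f (s \<oslash> m))"
      using dr by (simp add: D_map_def compose_def)
    then show ?thesis
      using h s by (auto simp: density_lifting_eq)
  qed
  with 1 show ?thesis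
    by (intro Pred_homI) (auto simp: p_obj_def p_mor_def density_lifting_eq)
qed

lemma density_lifting_counit:
  "D_counit (p_obj X) \<in> Pred_hom (density_lifting R S X) X"
proof -
  have "D_counit (snd X) l \<in> fst X" if "l \<in> fst (density_lifting R S X)" for l
  proof -
    have "l \<in> D_obj (snd X)"
      using that is_pred_density_lifting[of X] by (auto simp: is_pred_def density_lifting_def p_obj_def)
    with that show ?thesis
      by (auto simp: density_lifting_eq D_counit_def Pred_hom_def suffix_0)
  qed
  then show ?thesis
    using D_counit_in_hom[of "snd X"]
    by (auto simp: Pred_hom_def p_obj_def density_lifting_def)
qed

lemma density_lifting_comult:
  "D_comult (p_obj X) \<in> Pred_hom (density_lifting R S X)
     (density_lifting R S (density_lifting R S X))"
proof -
  have "D_comult (snd X) l \<in> fst (density_lifting R S (density_lifting R S X))"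
    if l: "l \<in> fst (density_lifting R S X)" for l
  proof -
    have lD: "l \<in> D_obj (snd X)"
      using l is_pred_density_lifting[of X] by (auto simp: is_pred_def density_lifting_def p_obj_def)
    obtain f s where f: "f \<in> Pred_hom S X" and s: "s \<in> fst S" and l_eq: "l = (\<lambda>m. f (s \<oslash> m))"
      using l by (auto simp: density_lifting_eq)
    have sD: "s \<oslash> m \<in> D_obj R" for m
      using S s by (auto simp: is_pred_def p_obj_def intro: suffix_in_D_obj)
    have "D_comult (snd X) l = (\<lambda>m. D_coext R (p_mor f) (s \<oslash> m))"
      using lD sD by (simp add: D_comult_apply D_coext_apply l_eq p_mor_def suffix_suffix)
        (simp add: suffix_def)
    then show ?thesis
      using coext_in_hom[OF f] s by (auto simp: density_lifting_eq[of "density_lifting R S X"])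
  qed
  then show ?thesis
    using D_comult_in_hom[of "snd X"]
    by (intro Pred_homI) (simp_all add: p_obj_def density_lifting_eq)
qed

end

end

theory Submission
  imports Defs
begin

text \<open>By \<open>density_lifting_eq\<close>, \<open>x\<close> lies in the lifted predicate iff
  it factors as \<open>x n = f (v \<oslash> n)\<close> with \<open>v\<close> in \<open>fst S\<close>
  and \<open>f\<close> a morphism from \<open>S\<close> to \<open>X\<close>. The two conditions say
  when such an \<open>f\<close> exists: equal suffixes must give equal entries for \<open>f\<close>
  to be well defined on the suffixes of \<open>v\<close>, and suffixes in \<open>fst S\<close> must
  be sent into \<open>fst X\<close>. Extending \<open>f\<close> to all of \<open>snd S\<close> is
  then free, since \<open>fst X\<close> contains a default value.\<close>

theorem theorem5p2:
  fixes R :: "'r set"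
    and S :: "(nat \<Rightarrow> 'r) pred_obj"
    and X :: "'a pred_obj"
    and x :: "nat \<Rightarrow> 'a"
  assumes "is_pred S" and "p_obj S = D_obj R"
    and "is_pred X"
    and "x \<in> D_obj (p_obj X)"
  shows "x \<in> fst (density_lifting R S X) \<longleftrightarrow>
    (\<exists>v\<in>fst S.
       (\<forall>i. v \<oslash> i \<in> fst S \<longrightarrow> x i \<in> fst X) \<and>
       (\<forall>m n. v \<oslash> n = v \<oslash> m \<longrightarrow> x n = x m))"
proof
  assume "x \<in> fst (density_lifting R S X)"
  then obtain f s where f: "f \<in> Pred_hom S X" and s: "s \<in> fst S" and x: "x = (\<lambda>m. f (s \<oslash> m))"
    by (auto simp: density_lifting_eq[OF assms(1,2)])
  show "\<exists>v\<in>fst S. (\<forall>i. v \<oslash> i \<in> fst S \<longrightarrow> x i \<in> fst X) \<and>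
      (\<forall>m n. v \<oslash> n = v \<oslash> m \<longrightarrow> x n = x m)"
    unfolding x using s Pred_homD(3)[OF f] by (intro bexI[of _ s] conjI allI impI) simp_all
next
  assume "\<exists>v\<in>fst S. (\<forall>i. v \<oslash> i \<in> fst S \<longrightarrow> x i \<in> fst X) \<and>
      (\<forall>m n. v \<oslash> n = v \<oslash> m \<longrightarrow> x n = x m)"
  then obtain v where v: "v \<in> fst S"
    and sub: "\<And>i. v \<oslash> i \<in> fst S \<Longrightarrow> x i \<in> fst X"
    and well_def: "\<And>m n. v \<oslash> n = v \<oslash> m \<Longrightarrow> x n = x m"
    by blast
  \<comment> \<open>Off the suffixes of \<open>v\<close>, the value \<open>x 0\<close> is harmless: it lies in \<open>fst X\<close> because
    \<open>v \<oslash> 0 = v \<in> fst S\<close>.\<close>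
  define f where "f = (\<lambda>t\<in>snd S. x (if \<exists>n. v \<oslash> n = t then SOME n. v \<oslash> n = t else 0))"
  have x0: "x 0 \<in> fst X"
    using sub[of 0] v by (simp add: suffix_0)
  have "v \<in> D_obj R"
    using v assms(1,2) by (auto simp: is_pred_def p_obj_def)
  then have suffix: "v \<oslash> n \<in> snd S" for n
    using suffix_in_D_obj assms(2) by (auto simp: p_obj_def)
  have f_suffix: "f (v \<oslash> n) = x n" for n
  proof -
    \<comment> \<open>The chosen index may differ from \<open>n\<close>, but it yields the same
      suffix, so \<open>well_def\<close> equates the two entries of \<open>x\<close>.\<close>
    have "v \<oslash> (SOME k. v \<oslash> k = v \<oslash> n) = v \<oslash> n"
      by (rule someI) (rule refl)
    then show ?thesis
      using suffix[of n] by (auto simp: f_def intro: well_def)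
  qed
  have f_other: "f t = x 0" if "t \<in> snd S" "\<nexists>n. v \<oslash> n = t" for t
    using that by (simp add: f_def)
  have "f \<in> Pred_hom S X"
  proof (rule Pred_homI)
    \<comment> \<open>On \<open>snd S\<close> every value of \<open>f\<close> is an entry of
      \<open>x\<close>, whichever index is picked.\<close>
    show "f \<in> snd S \<rightarrow>\<^sub>E snd X"
      using assms(4) by (auto simp: f_def in_D_obj_iff p_obj_def)
    show "f t \<in> fst X" if "t \<in> fst S" for t
    proof (cases "\<exists>n. v \<oslash> n = t")
      case True
      then show ?thesis
        using that sub f_suffix by auto
    next
      case False
      then show ?thesis
        using that f_other x0 assms(1) by (auto simp: is_pred_def)
    qed
  qed
  moreover have "x = (\<lambda>m. f (v \<oslash> m))"
    by (simp add: f_suffix)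
  ultimately show "x \<in> fst (density_lifting R S X)"
    using v by (auto simp: density_lifting_eq[OF assms(1,2)])
qed

end
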